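(* Let $0<p<1$ and let $P=pP_1+(1-p)P_2$, where $P_1$ and $P_2$ are the uniform distributions on $[0,1]$ and $[1,2]$. Let $n\ge 3$, and let $\alpha_n$ be an optimal set of $n$-means for $P$ containing elements from both $[0,1]$ and $(1,2]$, with $\alpha_n\cap[0,1]=\{a_1<a_2<\cdots<a_k\}$ and $\alpha_n\cap(1,2]=\{b_1<b_2<\cdots<b_m\}$, $k+m=n$. Suppose $k\geq 2$ and $m\geq 2$. If $\frac12(a_k+b_1)\leq 1$, then $a_j=\frac{(2j-1)(a_k+b_1)}{4k}$ for $1\leq j\leq k$, $b_1=E(X : X\in[\frac12(a_k+b_1),\frac12(b_1+b_2)])$, and \[b_{1+j}=\tfrac12(b_1+b_2)+\frac{2j-1}{2(m-1)}\Big(2-\tfrac12(b_1+b_2)\Big)\quad\text{for }1\leq j\leq m-1,\] and the $n$th quantization error is \[V1(k,m)=p\frac{(a_k+b_1)^3}{96k^2}+p\int_{\frac12(a_k+b_1)}^1(x-b_1)^2\,dx+(1-p)\int_1^{\frac12(b_1+b_2)}(x-b_1)^2\,dx+(1-p)\frac{(4-(b_1+b_2))^3}{96(m-1)^2}.\] If $1\leq\frac12(a_k+b_1)$, then $a_j=\frac{(2j-1)(a_{k-1}+a_k)}{4(k-1)}$ for $1\leq j\leq k-1$, $a_k=E(X : X\in[\frac12(a_{k-1}+a_k),\frac12(a_k+b_1)])$, and \[b_j=\tfrac12(a_k+b_1)+\frac{2j-1}{2m}\Big(2-\tfrac12(a_k+b_1)\Big)\quad\text{for }1\leq j\leq m,\]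 and the $n$th quantization error is \[V2(k,m)=p\frac{(a_{k-1}+a_k)^3}{96(k-1)^2}+p\int_{\frac12(a_{k-1}+a_k)}^1(x-a_k)^2\,dx+(1-p)\int_1^{\frac12(a_k+b_1)}(x-a_k)^2\,dx+(1-p)\frac{(4-(a_k+b_1))^3}{96m^2}.\]
   Context: For a Borel probability measure $P$ on $\mathbb{R}$ and $n\in\mathbb{N}$, the $n$th quantization error is $V_n(P)=\inf\{\int\min_{a\in\alpha}(x-a)^2\,dP(x) : \alpha\subset\mathbb{R},\ 1\le\mathrm{card}(\alpha)\le n\}$, and an optimal set of $n$-means for $P$ is a set $\alpha$ with $1\le\mathrm{card}(\alpha)\le n$ attaining this infimum (here it has exactly $n$ elements). $X$ is a random variable with distribution $P$, and $E(X:X\in[u,v])=\frac{1}{P([u,v])}\int_{[u,v]}x\,dP(x)$ is its conditional expectation given $X\in[u,v]$. $V1(k,m)$ denotes the $n$th quantization error when $\frac12(a_k+b_1)\le1$, and $V2(k,m)$ the $n$th quantization error when $1\le\frac12(a_k+b_1)$. *)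

theory Defs
  imports "HOL-Probability.Probability"
begin

text \<open>
  The mean squared error is a nonnegative (Lebesgue) integral in \<^typ>\<open>ennreal\<close>, so that the
  definitions are also meaningful for measures with infinite second moment, where the
  Bochner integral would be \<open>0\<close>.
\<close>

definition distortion :: "real measure \<Rightarrow> real set \<Rightarrow> ennreal" where
  "distortion P \<alpha> = (\<integral>\<^sup>+ x. ennreal (Min ((\<lambda>a. (x - a)\<^sup>2) ` \<alpha>)) \<partial>P)"

text \<open>As \<^const>\<open>card\<close> is \<open>0\<close> on infinite sets, \<open>1 \<le> card \<alpha>\<close> says that \<open>\<alpha>\<close> is finite and nonempty.\<close>

definition quantization_error :: "nat \<Rightarrow> real measure \<Rightarrow> ennreal" where
  "quantization_error n P = (INF \<alpha> \<in> {\<alpha>. 1 \<le> card \<alpha> \<and> card \<alpha> \<le> n}. distortion P \<alpha>)"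

definition optimal_n_means :: "nat \<Rightarrow> real measure \<Rightarrow> real set \<Rightarrow> bool" where
  "optimal_n_means n P \<alpha> \<longleftrightarrow>
     1 \<le> card \<alpha> \<and> card \<alpha> \<le> n \<and> distortion P \<alpha> = quantization_error n P"

text \<open>\<open>E(X : X \<in> [u, v])\<close> for a random variable \<open>X\<close> with distribution \<open>P\<close>.\<close>

definition cond_mean :: "real measure \<Rightarrow> real \<Rightarrow> real \<Rightarrow> real" where
  "cond_mean P u v = 1 / measure P {u..v} * (LINT x:{u..v}|P. x)"

definition mixture :: "real \<Rightarrow> 'a measure \<Rightarrow> 'a measure \<Rightarrow> 'a measure" where
  "mixture p M N = measure_of (space M) (sets M)
     (\<lambda>A. ennreal p * emeasure M A + ennreal (1 - p) * emeasure N A)"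

text \<open>
  A function passed to \<^const>\<open>measure_of\<close> is ignored unless it is a measure; the lemma shows
  that here it is one.
\<close>

lemma emeasure_mixture:
  assumes "sets N = sets M" and "A \<in> sets M"
  shows "emeasure (mixture p M N) A = ennreal p * emeasure M A + ennreal (1 - p) * emeasure N A"
  unfolding mixture_def
proof (rule emeasure_measure_of_sigma)
  show "sigma_algebra (space M) (sets M)"
    by (rule sets.sigma_algebra_axioms)
  show "positive (sets M) (\<lambda>A. ennreal p * emeasure M A + ennreal (1 - p) * emeasure N A)"
    by (simp add: positive_def)
  show "countably_additive (sets M)
          (\<lambda>A. ennreal p * emeasure M A + ennreal (1 - p) * emeasure N A)"
  proof (rule countably_additiveI)
    fix A :: "nat \<Rightarrow> 'a set"
    assume A: "range A \<subseteq> sets M" "disjoint_family A"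
    have "(\<Sum>i. emeasure M (A i)) = emeasure M (\<Union>i. A i)"
      using A by (intro suminf_emeasure) auto
    moreover have "(\<Sum>i. emeasure N (A i)) = emeasure N (\<Union>i. A i)"
      using A assms(1) by (intro suminf_emeasure) auto
    ultimately show "(\<Sum>i. ennreal p * emeasure M (A i) + ennreal (1 - p) * emeasure N (A i)) =
        ennreal p * emeasure M (\<Union>i. A i) + ennreal (1 - p) * emeasure N (\<Union>i. A i)"
      by (simp add: suminf_add[symmetric] ennreal_suminf_cmult)
  qed
qed (fact assms(2))

definition mixed_uniform :: "real \<Rightarrow> real measure" where
  "mixed_uniform p = mixture p (uniform_measure lborel {0..1}) (uniform_measure lborel {1..2})"

end

theory Submission
  imports Defs
begin

text \<open>
  The measure has density \<open>p\<close> on \<open>[0, 1]\<close> and \<open>1 - p\<close> on \<open>(1, 2]\<close>. The Voronoi cells of the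
  points \<open>c 1 < \<dots> < c n\<close> of an optimal set cut \<open>[0, 2]\<close> into \<open>n\<close> intervals, and the error is the
  sum over the cells of the squared distance to the point of the cell. If a point is moved while
  the partition is kept, this sum can only overestimate the error of the new set of points,
  which in turn is at least the optimal error. So the sum does not decrease, which forces every
  point to minimize the squared distance on its own cell, that is, to be the mean of the measure
  on its cell (\<open>optimal_point_is_centroid\<close>).

  The density is constant on every cell except the one that contains the breakpoint \<open>1\<close>, so
  every other point is the midpoint of its cell. Since conversely every interior cell boundary
  is the midpoint of the two neighbouring points, all half-cells on one side of the exceptional
  cell have the same length (\<open>evenly_spaced_if_midpoints\<close>). This determines the points on either
  side from the boundaries \<open>u\<close> and \<open>v\<close> of the exceptional cell, and \<open>N\<close> equal cells of total
  length \<open>L\<close> contribute \<open>L\<^sup>3 / (12 N\<^sup>2)\<close> times the density to the error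
  (\<open>evenly_spaced_error\<close>).

  Put together, this is \<open>optimal_means_if_breakpoint_in_cell\<close>, where the exceptional cell has an
  arbitrary index \<open>q\<close> with \<open>1 < q < n\<close>. If the midpoint between the last point in \<open>[0, 1]\<close> and
  the first point in \<open>(1, 2]\<close> is at most \<open>1\<close>, the exceptional cell belongs to the latter point,
  and if it is at least \<open>1\<close>, to the former. So the two halves of the theorem are two instances
  of the same lemma, with \<open>q = k + 1\<close> and \<open>q = k\<close>.
\<close>

section \<open>Integration against a two-step density\<close>

text \<open>
  On \<open>[0, 2]\<close> this is a density of the mixture: its two components overlap only in the null set
  \<open>{1}\<close>. It is extended to the whole line, and the restriction to \<open>[0, 2]\<close> is left to the
  interval of integration, so that integrals over adjacent intervals simply add up.
\<close>

definition step_weight :: "real \<Rightarrow> real \<Rightarrow> real" where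
  "step_weight p x = (if x \<le> 1 then p else 1 - p)"

definition weighted_integral :: "real \<Rightarrow> (real \<Rightarrow> real) \<Rightarrow> real \<Rightarrow> real \<Rightarrow> real" where
  "weighted_integral p f u v = integral {u..v} (\<lambda>x. step_weight p x * f x)"

definition min_sq_dist :: "real set \<Rightarrow> real \<Rightarrow> real" where
  "min_sq_dist \<alpha> x = Min ((\<lambda>a. (x - a)\<^sup>2) ` \<alpha>)"

lemma step_weight_measurable [measurable]: "step_weight p \<in> borel_measurable borel"
  unfolding step_weight_def by measurable

lemma has_integral_step_weight_left:
  fixes f :: "real \<Rightarrow> real"
  assumes "continuous_on UNIV f" and "v \<le> 1"
  shows "((\<lambda>x. step_weight p x * f x) has_integral p * integral {u..v} f) {u..v}"
proof -
  have "f integrable_on {u..v}"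
    using assms(1) by (intro integrable_continuous_real) (auto intro: continuous_on_subset)
  then have "((\<lambda>x. p * f x) has_integral p * integral {u..v} f) {u..v}"
    by (intro has_integral_mult_right integrable_integral)
  then show ?thesis
    using assms(2) by (rule_tac has_integral_eq[rotated]) (auto simp: step_weight_def)
qed

lemma has_integral_step_weight_right:
  fixes f :: "real \<Rightarrow> real"
  assumes "continuous_on UNIV f" and "1 \<le> u"
  shows "((\<lambda>x. step_weight p x * f x) has_integral (1 - p) * integral {u..v} f) {u..v}"
proof -
  have "f integrable_on {u..v}"
    using assms(1) by (intro integrable_continuous_real) (auto intro: continuous_on_subset)
  then have "((\<lambda>x. (1 - p) * f x) has_integral (1 - p) * integral {u..v} f) {u..v}"
    by (intro has_integral_mult_right integrable_integral)
  then show ?thesis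
    using assms(2)
    by (rule_tac has_integral_spike_finite[of "{1}"]) (auto simp: step_weight_def)
qed

lemma weighted_integral_left:
  assumes "continuous_on UNIV f" and "v \<le> 1"
  shows "weighted_integral p f u v = p * integral {u..v} f"
  unfolding weighted_integral_def
  using has_integral_step_weight_left[OF assms] by (rule integral_unique)

lemma weighted_integral_right:
  assumes "continuous_on UNIV f" and "1 \<le> u"
  shows "weighted_integral p f u v = (1 - p) * integral {u..v} f"
  unfolding weighted_integral_def
  using has_integral_step_weight_right[OF assms] by (rule integral_unique)

lemma step_weight_integrable:
  fixes f :: "real \<Rightarrow> real"
  assumes "continuous_on UNIV f"
  shows "(\<lambda>x. step_weight p x * f x) integrable_on {u..v}"
proof -
  consider "v \<le> 1" | "1 \<le> u" | "u \<le> 1" "1 \<le> v" by linarith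
  then show ?thesis
  proof cases
    case 3
    then show ?thesis
      using has_integral_step_weight_left[OF assms, of 1 p u]
        has_integral_step_weight_right[OF assms, of 1 p v]
      by (intro Henstock_Kurzweil_Integration.integrable_combine[OF 3]) blast+
  qed (use has_integral_step_weight_left[OF assms] has_integral_step_weight_right[OF assms]
        in blast)+
qed

lemma weighted_integral_combine:
  assumes "continuous_on UNIV f" and "u \<le> v" and "v \<le> w"
  shows "weighted_integral p f u v + weighted_integral p f v w = weighted_integral p f u w"
  unfolding weighted_integral_def
  using assms(2,3) step_weight_integrable[OF assms(1)]
  by (rule Henstock_Kurzweil_Integration.integral_combine)

lemma weighted_integral_mono:
  assumes "continuous_on UNIV f" and "continuous_on UNIV g" and "0 \<le> p" and "p \<le> 1"
    and "\<And>x. x \<in> {u..v} \<Longrightarrow> f x \<le> g x"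
  shows "weighted_integral p f u v \<le> weighted_integral p g u v"
  unfolding weighted_integral_def
  using assms by (intro integral_le step_weight_integrable mult_left_mono)
    (auto simp: step_weight_def)

lemma weighted_integral_cong:
  assumes "\<And>x. x \<in> {u..v} \<Longrightarrow> f x = g x"
  shows "weighted_integral p f u v = weighted_integral p g u v"
  unfolding weighted_integral_def using assms by (intro integral_cong) auto

lemma weighted_integral_partition:
  fixes e :: "nat \<Rightarrow> real"
  assumes "continuous_on UNIV f" and "\<And>i. i \<in> {0<..n} \<Longrightarrow> e (i - 1) \<le> e i"
  shows "e 0 \<le> e n \<and>
    weighted_integral p f (e 0) (e n) = (\<Sum>i\<in>{0<..n}. weighted_integral p f (e (i - 1)) (e i))"
  using assms(2)
proof (induction n)
  case 0
  then show ?case by (simp add: weighted_integral_def)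
next
  case (Suc n)
  have IH: "e 0 \<le> e n"
    "weighted_integral p f (e 0) (e n) = (\<Sum>i\<in>{0<..n}. weighted_integral p f (e (i - 1)) (e i))"
    using Suc.IH Suc.prems by auto
  have le: "e n \<le> e (Suc n)"
    using Suc.prems[of "Suc n"] by simp
  have "{0<..Suc n} = insert (Suc n) {0<..n}" by auto
  then show ?case
    using IH le weighted_integral_combine[OF assms(1) IH(1) le, of p] by simp
qed

text \<open>
  As a function of \<open>y\<close>, the squared distance to \<open>y\<close> is a quadratic polynomial whose coefficients
  are the first three moments of the measure on the interval.
\<close>

lemma weighted_integral_square:
  "weighted_integral p (\<lambda>x. (x - y)\<^sup>2) u v =
     weighted_integral p (\<lambda>x. x\<^sup>2) u v - 2 * y * weighted_integral p (\<lambda>x. x) u v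
       + y\<^sup>2 * weighted_integral p (\<lambda>x. 1) u v"
proof -
  have I: "((\<lambda>x. step_weight p x * f x) has_integral weighted_integral p f u v) {u..v}"
    if "continuous_on UNIV f" for f
    unfolding weighted_integral_def
    using step_weight_integrable[OF that] by (rule integrable_integral)
  have sq: "((\<lambda>x. step_weight p x * x\<^sup>2) has_integral weighted_integral p (\<lambda>x. x\<^sup>2) u v) {u..v}"
    by (rule I) (intro continuous_intros)
  have id: "((\<lambda>x. step_weight p x * x) has_integral weighted_integral p (\<lambda>x. x) u v) {u..v}"
    by (rule I) (intro continuous_intros)
  have one: "((\<lambda>x. step_weight p x * 1) has_integral weighted_integral p (\<lambda>x. 1) u v) {u..v}"
    by (rule I) (intro continuous_intros)
  have expand: "step_weight p x * (x - y)\<^sup>2 =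
      step_weight p x * x\<^sup>2 - 2 * y * (step_weight p x * x) + y\<^sup>2 * (step_weight p x * 1)" for x
    by (simp add: power2_eq_square algebra_simps)
  have "((\<lambda>x. step_weight p x * (x - y)\<^sup>2) has_integral
      (weighted_integral p (\<lambda>x. x\<^sup>2) u v - 2 * y * weighted_integral p (\<lambda>x. x) u v
       + y\<^sup>2 * weighted_integral p (\<lambda>x. 1) u v)) {u..v}"
    unfolding expand by (intro has_integral_add has_integral_diff has_integral_mult_right sq id one)
  from integral_unique[OF this] show ?thesis
    by (subst weighted_integral_def)
qed

lemma weighted_integral_one_pos:
  assumes "0 < p" and "p < 1" and "u < v"
  shows "0 < weighted_integral p (\<lambda>x. 1) u v"
proof -
  have "0 < integral {u..v} (\<lambda>x. min p (1 - p))"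
    using assms by simp
  also have "\<dots> \<le> weighted_integral p (\<lambda>x. 1) u v"
    unfolding weighted_integral_def
    by (intro integral_le step_weight_integrable) (auto simp: step_weight_def)
  finally show ?thesis .
qed

text \<open>
  With mass \<open>W\<close> and first moment \<open>M\<close>, completing the square shows that replacing \<open>M / W\<close> by
  \<open>c\<close> costs exactly \<open>W * (c - M / W)\<^sup>2\<close>.
\<close>

lemma minimizer_is_centroid:
  assumes p: "0 < p" "p < 1" and "u < v"
    and min: "\<And>y. weighted_integral p (\<lambda>x. (x - c)\<^sup>2) u v \<le> weighted_integral p (\<lambda>x. (x - y)\<^sup>2) u v"
  shows "c = weighted_integral p (\<lambda>x. x) u v / weighted_integral p (\<lambda>x. 1) u v"
proof -
  define M where "M = weighted_integral p (\<lambda>x. x) u v"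
  define W where "W = weighted_integral p (\<lambda>x. 1) u v"
  have W: "W > 0"
    unfolding W_def using assms by (intro weighted_integral_one_pos)
  \<comment> \<open>The second moment is common to both sides and cancels.\<close>
  have "- 2 * c * M + c\<^sup>2 * W \<le> - 2 * (M / W) * M + (M / W)\<^sup>2 * W"
    using min[of "M / W"] unfolding weighted_integral_square M_def[symmetric] W_def[symmetric]
    by simp
  moreover have "- 2 * c * M + c\<^sup>2 * W - (- 2 * (M / W) * M + (M / W)\<^sup>2 * W) = W * (c - M / W)\<^sup>2"
    using W by (simp add: power2_eq_square field_simps)
  ultimately have "W * (c - M / W)\<^sup>2 \<le> 0" by linarith
  then have "(c - M / W)\<^sup>2 \<le> 0"
    using W by (simp add: mult_le_0_iff)
  then show ?thesis
    by (simp add: M_def W_def)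
qed

lemma integral_ident_interval:
  fixes u v :: real
  assumes "u \<le> v"
  shows "integral {u..v} (\<lambda>x. x) = (v\<^sup>2 - u\<^sup>2) / 2"
proof -
  have "((\<lambda>x. x) has_integral (v\<^sup>2 / 2 - u\<^sup>2 / 2)) {u..v}"
    using assms
    by (intro fundamental_theorem_of_calculus)
      (auto intro!: derivative_eq_intros simp: has_real_derivative_iff_has_vector_derivative[symmetric])
  then show ?thesis by (simp add: integral_unique diff_divide_distrib)
qed

text \<open>
  The constant \<open>12\<close> comes from the variance of a uniform distribution.
\<close>

lemma integral_square_midpoint:
  fixes u v :: real
  assumes "u \<le> v"
  shows "integral {u..v} (\<lambda>x. (x - (u + v) / 2)\<^sup>2) = (v - u) ^ 3 / 12"
proof -
  let ?F = "\<lambda>x. (x - (u + v) / 2) ^ 3 / 3"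
  have "((\<lambda>x. (x - (u + v) / 2)\<^sup>2) has_integral (?F v - ?F u)) {u..v}"
    using assms
    by (intro fundamental_theorem_of_calculus)
      (auto intro!: derivative_eq_intros simp: has_real_derivative_iff_has_vector_derivative[symmetric])
  moreover have "?F v - ?F u = (v - u) ^ 3 / 12"
    by (simp add: power3_eq_cube field_simps)
  ultimately show ?thesis by (metis integral_unique)
qed

lemma centroid_left:
  assumes "0 < p" and "u < v" and "v \<le> 1"
  shows "weighted_integral p (\<lambda>x. x) u v / weighted_integral p (\<lambda>x. 1) u v = (u + v) / 2"
proof -
  have "(v\<^sup>2 - u\<^sup>2) / (2 * (v - u)) = (u + v) / 2"
    using assms by (simp add: field_simps power2_eq_square)
  then show ?thesis
    using assms by (simp add: weighted_integral_left integral_ident_interval)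
qed

lemma centroid_right:
  assumes "p < 1" and "u < v" and "1 \<le> u"
  shows "weighted_integral p (\<lambda>x. x) u v / weighted_integral p (\<lambda>x. 1) u v = (u + v) / 2"
proof -
  have "(v\<^sup>2 - u\<^sup>2) / (2 * (v - u)) = (u + v) / 2"
    using assms by (simp add: field_simps power2_eq_square)
  then show ?thesis
    using assms by (simp add: weighted_integral_right integral_ident_interval)
qed

section \<open>The mixture of the two uniform distributions\<close>

text \<open>
  This turns every integral with respect to the mixture into an integral over a real interval.
\<close>

lemma mixed_uniform_eq_density:
  assumes "0 \<le> p" and "p \<le> 1"
  shows "mixed_uniform p = density lborel (\<lambda>x. ennreal (step_weight p x * indicator {0..2} x))"
proof (rule measure_eqI)
  show "sets (mixed_uniform p) =
      sets (density lborel (\<lambda>x. ennreal (step_weight p x * indicator {0..2} x)))"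
    by (simp add: mixed_uniform_def mixture_def sets.sigma_sets_eq[of "borel :: real measure", simplified])
next
  fix A assume "A \<in> sets (mixed_uniform p)"
  then have A: "A \<in> sets borel"
    by (simp add: mixed_uniform_def mixture_def sets.sigma_sets_eq[of "borel :: real measure", simplified])
  have "emeasure (mixed_uniform p) A =
      ennreal p * emeasure lborel ({0..1} \<inter> A) + ennreal (1 - p) * emeasure lborel ({1..2} \<inter> A)"
    using A by (simp add: mixed_uniform_def emeasure_mixture divide_ennreal_def)
  also have "\<dots> = (\<integral>\<^sup>+x. ennreal p * indicator ({0..1} \<inter> A) x
      + ennreal (1 - p) * indicator ({1..2} \<inter> A) x \<partial>lborel)"
    using A by (subst nn_integral_add) (auto simp: nn_integral_cmult)
  also have "\<dots> = (\<integral>\<^sup>+x. ennreal (step_weight p x * indicator {0..2} x) * indicator A x \<partial>lborel)"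
  proof (rule nn_integral_cong_AE)
    show "AE x in lborel. ennreal p * indicator ({0..1} \<inter> A) x
        + ennreal (1 - p) * indicator ({1..2} \<inter> A) x =
      ennreal (step_weight p x * indicator {0..2} x) * indicator A x"
      using AE_lborel_singleton[of "1 :: real"]
      by eventually_elim (auto simp: step_weight_def indicator_def)
  qed
  also have "\<dots> = emeasure (density lborel (\<lambda>x. ennreal (step_weight p x * indicator {0..2} x))) A"
    using A by (intro emeasure_density[symmetric] measurable_compose[OF _ measurable_ennreal]
        borel_measurable_times borel_measurable_indicator) auto
  finally show "emeasure (mixed_uniform p) A =
    emeasure (density lborel (\<lambda>x. ennreal (step_weight p x * indicator {0..2} x))) A" .
qed

lemma nn_integral_mixed_uniform:
  assumes p: "0 \<le> p" "p \<le> 1" and f: "continuous_on UNIV f" "\<And>x. 0 \<le> f x"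
    and uv: "0 \<le> u" "v \<le> 2"
  shows "(\<integral>\<^sup>+x. ennreal (f x * indicator {u..v} x) \<partial>mixed_uniform p) = ennreal (weighted_integral p f u v)"
proof -
  have [measurable]: "f \<in> borel_measurable borel"
    using f(1) by (rule borel_measurable_continuous_onI)
  have w: "0 \<le> step_weight p x" for x using p by (simp add: step_weight_def)
  have "(\<integral>\<^sup>+x. ennreal (f x * indicator {u..v} x) \<partial>mixed_uniform p) =
      (\<integral>\<^sup>+x. ennreal (step_weight p x * indicator {0..2} x) * ennreal (f x * indicator {u..v} x) \<partial>lborel)"
    unfolding mixed_uniform_eq_density[OF p] by (subst nn_integral_density) auto
  also have "\<dots> = (\<integral>\<^sup>+x. ennreal (indicator {u..v} x * (step_weight p x * f x)) \<partial>lborel)"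
    using uv by (intro nn_integral_cong) (auto simp: ennreal_mult[symmetric] w f indicator_def)
  also have "\<dots> = ennreal (weighted_integral p f u v)"
    unfolding weighted_integral_def
    using step_weight_integrable[OF f(1), of p u v] w f(2)
    by (intro nn_integral_has_integral_lebesgue integrable_integral) auto
  finally show ?thesis .
qed

text \<open>
  Only the values of \<open>f\<close> on the interval matter, so the identity function, which is negative
  elsewhere, is covered as well; the proof passes to the positive part of \<open>f\<close>, which is
  nonnegative everywhere.
\<close>

lemma set_lebesgue_integral_mixed_uniform:
  assumes p: "0 \<le> p" "p \<le> 1" and f: "continuous_on UNIV f" "\<And>x. x \<in> {u..v} \<Longrightarrow> 0 \<le> f x"
    and uv: "0 \<le> u" "v \<le> 2"
  shows "(LINT x:{u..v}|mixed_uniform p. f x) = weighted_integral p f u v"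
proof -
  define g where "g x = max 0 (f x)" for x
  have g: "continuous_on UNIV g" unfolding g_def using f(1) by (intro continuous_intros)
  then have [measurable]: "g \<in> borel_measurable borel" by (rule borel_measurable_continuous_onI)
  have [measurable_cong]: "sets (mixed_uniform p) = sets borel"
    by (simp add: mixed_uniform_eq_density[OF p])
  have nn: "0 \<le> g x" for x by (simp add: g_def)
  have "(LINT x:{u..v}|mixed_uniform p. f x) = (\<integral>x. g x * indicator {u..v} x \<partial>mixed_uniform p)"
    unfolding set_lebesgue_integral_def using f(2)
    by (intro Bochner_Integration.integral_cong) (auto simp: g_def indicator_def)
  also have "\<dots> = enn2real (\<integral>\<^sup>+x. ennreal (g x * indicator {u..v} x) \<partial>mixed_uniform p)"
    by (intro integral_eq_nn_integral AE_I2) (measurable, simp add: nn)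
  also have "\<dots> = weighted_integral p g u v"
  proof (subst nn_integral_mixed_uniform[OF p g _ uv])
    have "0 \<le> weighted_integral p g u v"
      unfolding weighted_integral_def using p
      by (intro integral_nonneg step_weight_integrable g) (auto simp: step_weight_def g_def)
    then show "enn2real (ennreal (weighted_integral p g u v)) = weighted_integral p g u v" by simp
  qed (simp add: g_def)
  also have "\<dots> = weighted_integral p f u v"
    using f(2) by (intro weighted_integral_cong) (auto simp: g_def)
  finally show ?thesis .
qed

lemma cond_mean_mixed_uniform:
  assumes "0 \<le> p" and "p \<le> 1" and "0 \<le> u" and "v \<le> 2"
  shows "cond_mean (mixed_uniform p) u v =
    weighted_integral p (\<lambda>x. x) u v / weighted_integral p (\<lambda>x. 1) u v"
proof -
  have "measure (mixed_uniform p) {u..v} = (LINT x:{u..v}|mixed_uniform p. 1)"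
    by (simp add: set_lebesgue_integral_def mixed_uniform_eq_density assms)
  then show ?thesis
    unfolding cond_mean_def using assms set_lebesgue_integral_mixed_uniform[of p "\<lambda>x. x" u v]
    by (simp add: set_lebesgue_integral_mixed_uniform)
qed

lemma continuous_min_sq_dist:
  assumes "finite \<alpha>" and "\<alpha> \<noteq> {}"
  shows "continuous_on UNIV (min_sq_dist \<alpha>)"
  using assms
proof (induction \<alpha> rule: finite_ne_induct)
  case (singleton a)
  then show ?case unfolding min_sq_dist_def by (simp, intro continuous_intros)
next
  case (insert a F)
  have "min_sq_dist (insert a F) = (\<lambda>x. min ((x - a)\<^sup>2) (min_sq_dist F x))"
    using insert.hyps by (simp add: fun_eq_iff min_sq_dist_def)
  then show ?case using insert.IH by (auto intro!: continuous_intros)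
qed

lemma distortion_mixed_uniform:
  assumes p: "0 \<le> p" "p \<le> 1" and \<alpha>: "finite \<alpha>" "\<alpha> \<noteq> {}"
  shows "distortion (mixed_uniform p) \<alpha> = ennreal (weighted_integral p (min_sq_dist \<alpha>) 0 2)"
proof -
  have nn: "0 \<le> min_sq_dist \<alpha> x" for x
    unfolding min_sq_dist_def using \<alpha> by (subst Min_ge_iff) auto
  have [measurable]: "min_sq_dist \<alpha> \<in> borel_measurable borel"
    using continuous_min_sq_dist[OF \<alpha>] by (rule borel_measurable_continuous_onI)
  have "distortion (mixed_uniform p) \<alpha> = (\<integral>\<^sup>+x. ennreal (min_sq_dist \<alpha> x) \<partial>mixed_uniform p)"
    by (simp add: distortion_def min_sq_dist_def)
  also have "\<dots> = (\<integral>\<^sup>+x. ennreal (min_sq_dist \<alpha> x * indicator {0..2} x) \<partial>mixed_uniform p)"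
    unfolding mixed_uniform_eq_density[OF p]
    by (subst (1 2) nn_integral_density) (auto intro!: nn_integral_cong simp: indicator_def)
  also have "\<dots> = ennreal (weighted_integral p (min_sq_dist \<alpha>) 0 2)"
    by (intro nn_integral_mixed_uniform p nn continuous_min_sq_dist \<alpha>) auto
  finally show ?thesis .
qed

section \<open>Voronoi cells and the centroid condition\<close>

text \<open>
  The points are \<open>c 1 < \<dots> < c n\<close>, and the Voronoi cell of \<open>c i\<close> in \<open>[0, 2]\<close> is the interval from
  \<open>cell_bound n c (i - 1)\<close> to \<open>cell_bound n c i\<close>; the first and the last cell end at \<open>0\<close> and \<open>2\<close>.
\<close>

definition cell_bound :: "nat \<Rightarrow> (nat \<Rightarrow> real) \<Rightarrow> nat \<Rightarrow> real" where
  "cell_bound n c i = (if i = 0 then 0 else if i = n then 2 else (c i + c (Suc i)) / 2)"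

lemma cell_bound_less:
  assumes c: "strict_mono_on {1..n} c" "c ` {1..n} \<subseteq> {0..2}" and i: "i \<in> {0<..n}"
  shows "cell_bound n c (i - 1) < cell_bound n c i"
proof -
  have lt: "c j < c (Suc j)" if "1 \<le> j" "Suc j \<le> n" for j
    using that by (intro strict_mono_onD[OF c(1)]) auto
  have rng: "0 \<le> c j \<and> c j \<le> 2" if "1 \<le> j" "j \<le> n" for j
    using c(2) that by (auto simp: image_subset_iff)
  consider "i = 1" | "1 < i" "i < n" | "1 < i" "i = n"
    using i by fastforce
  then show ?thesis
  proof cases
    case 1
    then show ?thesis
      using i lt[of 1] rng[of 1] rng[of 2] by (auto simp: cell_bound_def numeral_2_eq_2)
  next
    case 2
    then have "c (i - 1) < c i" "c i < c (Suc i)"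
      using lt[of i] lt[of "i - 1"] by auto
    then show ?thesis
      using 2 by (auto simp: cell_bound_def)
  next
    case 3
    then have "c (i - 1) < c i" "c i \<le> 2"
      using lt[of "i - 1"] rng[of i] by auto
    then show ?thesis
      using 3 by (simp add: cell_bound_def)
  qed
qed

lemma cell_bound_mono:
  assumes c: "strict_mono_on {1..n} c" "c ` {1..n} \<subseteq> {0..2}" and "i \<le> j" "j \<le> n"
  shows "cell_bound n c i \<le> cell_bound n c j"
  using assms(3,4)
proof (induction j rule: dec_induct)
  case (step j)
  then show ?case using cell_bound_less[OF c, of "Suc j"] by simp
qed simp

text \<open>
  For another point \<open>c j\<close>, the difference \<open>(x - c j)\<^sup>2 - (x - c i)\<^sup>2\<close> factors as
  \<open>(c i - c j) * (2 * x - c i - c j)\<close>. By monotonicity it is enough to know on which side of \<open>x\<close>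
  the boundary between \<open>c i\<close> and its immediate neighbour lies.
\<close>

lemma min_sq_dist_on_cell:
  assumes c: "strict_mono_on {1..n} c" and i: "i \<in> {0<..n}"
    and x: "x \<in> {cell_bound n c (i - 1)..cell_bound n c i}"
  shows "min_sq_dist (c ` {1..n}) x = (x - c i)\<^sup>2"
  unfolding min_sq_dist_def
proof (rule Min_eqI)
  fix y assume "y \<in> (\<lambda>a. (x - a)\<^sup>2) ` c ` {1..n}"
  then obtain j where j: "j \<in> {1..n}" "y = (x - c j)\<^sup>2" by auto
  have le: "c r \<le> c s" if "r \<le> s" "1 \<le> r" "s \<le> n" for r s
    using that strict_mono_onD[OF c, of r s] by (cases "r = s") auto
  have "0 \<le> (c i - c j) * (2 * x - c i - c j)"
  proof (cases j i rule: linorder_cases)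
    case less
    then have "c j \<le> c (i - 1)" "c j \<le> c i" using i j by (auto intro!: le)
    moreover have "2 * x \<ge> c (i - 1) + c i"
      using x less i j by (auto simp: cell_bound_def split: if_splits)
    ultimately show ?thesis by (intro mult_nonneg_nonneg) linarith+
  next
    case greater
    then have "c (Suc i) \<le> c j" "c i \<le> c j" using i j by (auto intro!: le)
    moreover have "2 * x \<le> c i + c (Suc i)"
      using x greater i j by (auto simp: cell_bound_def split: if_splits)
    ultimately show ?thesis by (intro mult_nonpos_nonpos) linarith+
  qed simp
  then show "(x - c i)\<^sup>2 \<le> y"
    unfolding j by (simp add: power2_eq_square algebra_simps)
qed (use i in auto)

lemma optimal_error:
  assumes p: "0 \<le> p" "p \<le> 1" and c: "strict_mono_on {1..n} c" "c ` {1..n} \<subseteq> {0..2}" and n: "1 \<le> n"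
    and opt: "optimal_n_means n (mixed_uniform p) (c ` {1..n})"
  shows "quantization_error n (mixed_uniform p) = ennreal (\<Sum>i\<in>{0<..n}.
    weighted_integral p (\<lambda>x. (x - c i)\<^sup>2) (cell_bound n c (i - 1)) (cell_bound n c i))"
proof -
  let ?e = "cell_bound n c"
  have "quantization_error n (mixed_uniform p) =
      ennreal (weighted_integral p (min_sq_dist (c ` {1..n})) (?e 0) (?e n))"
    using opt n distortion_mixed_uniform[OF p, of "c ` {1..n}"]
    by (simp add: optimal_n_means_def cell_bound_def)
  also have "weighted_integral p (min_sq_dist (c ` {1..n})) (?e 0) (?e n) =
      (\<Sum>i\<in>{0<..n}. weighted_integral p (min_sq_dist (c ` {1..n})) (?e (i - 1)) (?e i))"
    using n cell_bound_less[OF c]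
    by (intro weighted_integral_partition[where e = ?e, THEN conjunct2] continuous_min_sq_dist)
      (auto intro: less_imp_le)
  also have "\<dots> = (\<Sum>i\<in>{0<..n}. weighted_integral p (\<lambda>x. (x - c i)\<^sup>2) (?e (i - 1)) (?e i))"
    by (intro sum.cong refl weighted_integral_cong min_sq_dist_on_cell[OF c(1)])
  finally show ?thesis .
qed

text \<open>
  An arbitrary partition, not adapted to the points, can only overestimate their error, because
  it assigns some arguments to a point that is not the nearest one. The points may be in any
  order and may even coincide.
\<close>

lemma quantization_error_le_partition:
  assumes p: "0 \<le> p" "p \<le> 1" and n: "1 \<le> n"
    and e: "\<And>i. i \<in> {0<..n} \<Longrightarrow> e (i - 1) \<le> e i" "e 0 = 0" "e n = 2"
  shows "quantization_error n (mixed_uniform p) \<le>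
    ennreal (\<Sum>i\<in>{0<..n}. weighted_integral p (\<lambda>x. (x - c i)\<^sup>2) (e (i - 1)) (e i))"
proof -
  let ?\<beta> = "c ` {1..n}"
  have cont: "continuous_on UNIV (min_sq_dist ?\<beta>)"
    using n by (intro continuous_min_sq_dist) auto
  have "card ?\<beta> \<le> n" using card_image_le[of "{1..n}" c] by simp
  moreover have "1 \<le> card ?\<beta>" using n by (simp add: Suc_le_eq card_gt_0_iff)
  ultimately have "quantization_error n (mixed_uniform p) \<le> distortion (mixed_uniform p) ?\<beta>"
    unfolding quantization_error_def by (intro INF_lower) simp
  also have "\<dots> = ennreal (weighted_integral p (min_sq_dist ?\<beta>) (e 0) (e n))"
    unfolding e using n by (intro distortion_mixed_uniform p) auto
  also have "weighted_integral p (min_sq_dist ?\<beta>) (e 0) (e n) =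
      (\<Sum>i\<in>{0<..n}. weighted_integral p (min_sq_dist ?\<beta>) (e (i - 1)) (e i))"
    using weighted_integral_partition[where e = e, OF cont e(1)] by blast
  also have "ennreal \<dots> \<le> ennreal (\<Sum>i\<in>{0<..n}. weighted_integral p (\<lambda>x. (x - c i)\<^sup>2) (e (i - 1)) (e i))"
  proof (intro ennreal_leI sum_mono weighted_integral_mono cont p)
    fix i x assume "i \<in> {0<..n}"
    then show "min_sq_dist ?\<beta> x \<le> (x - c i)\<^sup>2"
      unfolding min_sq_dist_def by (intro Min_le) auto
  qed (intro continuous_intros)
  finally show ?thesis .
qed

text \<open>
  Moving the single point \<open>c i\<close> to \<open>y\<close> while keeping the cells of \<open>c\<close> changes one summand only.
  As the old sum is the optimal error and the new sum an upper bound for it, that summand cannot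
  decrease.
\<close>

lemma optimal_point_is_centroid:
  assumes p: "0 < p" "p < 1" and c: "strict_mono_on {1..n} c" "c ` {1..n} \<subseteq> {0..2}" and n: "1 \<le> n"
    and opt: "optimal_n_means n (mixed_uniform p) (c ` {1..n})" and i: "i \<in> {0<..n}"
  shows "c i = weighted_integral p (\<lambda>x. x) (cell_bound n c (i - 1)) (cell_bound n c i) /
    weighted_integral p (\<lambda>x. 1) (cell_bound n c (i - 1)) (cell_bound n c i)"
proof (rule minimizer_is_centroid[OF p cell_bound_less[OF c i]])
  fix y
  let ?e = "cell_bound n c"
  let ?J = "\<lambda>c i. weighted_integral p (\<lambda>x. (x - c i)\<^sup>2) (?e (i - 1)) (?e i)"
  have p': "0 \<le> p" "p \<le> 1" using p by auto
  have nn: "0 \<le> ?J d i" for d i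
    unfolding weighted_integral_def using p
    by (intro integral_nonneg step_weight_integrable continuous_intros) (auto simp: step_weight_def)
  have "ennreal (\<Sum>i\<in>{0<..n}. ?J c i) \<le> ennreal (\<Sum>j\<in>{0<..n}. ?J (c(i := y)) j)"
    unfolding optimal_error[OF p' c n opt, symmetric]
    using n cell_bound_less[OF c]
    by (intro quantization_error_le_partition p')
      (auto simp: cell_bound_def[of _ _ 0] cell_bound_def[of n c n] intro: less_imp_le)
  then have "(\<Sum>i\<in>{0<..n}. ?J c i) \<le> (\<Sum>j\<in>{0<..n}. ?J (c(i := y)) j)"
    by (subst (asm) ennreal_le_iff) (intro sum_nonneg nn)
  moreover have "(\<Sum>j\<in>{0<..n} - {i}. ?J (c(i := y)) j) = (\<Sum>j\<in>{0<..n} - {i}. ?J c j)"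
    by (intro sum.cong) auto
  ultimately show "?J c i \<le> weighted_integral p (\<lambda>x. (x - y)\<^sup>2) (?e (i - 1)) (?e i)"
    using i by (simp add: sum.remove[of _ i])
qed

section \<open>Cells on which the density is constant\<close>

text \<open>
  The points are midpoints between boundaries and the boundaries are midpoints between points,
  so points and boundaries together form an arithmetic progression, with \<open>2 * (t - s)\<close> steps from
  \<open>e s\<close> to \<open>e t\<close>.
\<close>

lemma evenly_spaced_if_midpoints:
  fixes e c :: "nat \<Rightarrow> real"
  assumes mid: "\<And>i. i \<in> {s<..t} \<Longrightarrow> c i = (e (i - 1) + e i) / 2"
    and bd: "\<And>i. i \<in> {s<..<t} \<Longrightarrow> e i = (c i + c (Suc i)) / 2"
    and st: "s < t"
  shows evenly_spaced_points: "j \<in> {1..t - s} \<Longrightarrow>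
      c (s + j) = e s + (2 * real j - 1) / (2 * real (t - s)) * (e t - e s)"
    and evenly_spaced_bounds: "i \<in> {s<..t} \<Longrightarrow> e i - e (i - 1) = (e t - e s) / real (t - s)"
proof -
  \<comment> \<open>The first cell determines all the others: \<open>h\<close> is the common length of the cells.\<close>
  define h where "h = e (Suc s) - e s"
  have gap: "e i = e s + real (i - s) * h" if "s \<le> i" "i \<le> t" for i
    using that
  proof (induction i rule: less_induct)
    case (less i)
    consider "i = s" | "i = Suc s" | r where "i = Suc (Suc r)" "s \<le> r"
    proof (cases "i \<le> Suc s")
      case True
      then show ?thesis using less.prems that(1,2) by linarith
    next
      case False
      then show ?thesis using that(3)[of "i - 2"] by simp
    qed
    then show ?case
    proof cases
      case 3
      have "c (Suc r) = (e r + e (Suc r)) / 2" "c i = (e (Suc r) + e i) / 2"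
        "e (Suc r) = (c (Suc r) + c i) / 2"
        using mid[of "Suc r"] mid[of i] bd[of "Suc r"] 3 less.prems by auto
      then have rec: "e i = 2 * e (Suc r) - e r" by argo
      have "e r = e s + real (r - s) * h" "e (Suc r) = e s + real (Suc r - s) * h"
        using less.IH[of r] less.IH[of "Suc r"] 3 less.prems by auto
      then show ?thesis
        unfolding rec using 3 by (simp add: of_nat_diff algebra_simps)
    qed (auto simp: h_def)
  qed
  have h: "h = (e t - e s) / real (t - s)"
    using gap[of t] st by simp
  have step: "e (i - 1) = e i - h" if "i \<in> {s<..t}" for i
  proof -
    have "real (i - 1 - s) = real (i - s) - 1" using that by auto
    moreover have "e i = e s + real (i - s) * h" "e (i - 1) = e s + real (i - 1 - s) * h"
      using that by (intro gap; force)+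
    ultimately show ?thesis
      by (simp add: left_diff_distrib)
  qed
  show "e i - e (i - 1) = (e t - e s) / real (t - s)" if "i \<in> {s<..t}"
    using step[OF that] h by simp
  show "c (s + j) = e s + (2 * real j - 1) / (2 * real (t - s)) * (e t - e s)" if "j \<in> {1..t - s}"
  proof -
    have i: "s + j \<in> {s<..t}" using that st by auto
    have "e (s + j) = e s + real j * h" using gap[of "s + j"] i by simp
    then have "c (s + j) = e s + (real j - 1 / 2) * h"
      using mid[OF i] step[OF i] by (simp add: algebra_simps)
    then show ?thesis
      using st unfolding h by (simp add: field_simps)
  qed
qed

lemma evenly_spaced_error:
  fixes e c :: "nat \<Rightarrow> real"
  assumes mid: "\<And>i. i \<in> {s<..t} \<Longrightarrow> c i = (e (i - 1) + e i) / 2"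
    and bd: "\<And>i. i \<in> {s<..<t} \<Longrightarrow> e i = (c i + c (Suc i)) / 2"
    and st: "s < t" and mono: "\<And>i. i \<in> {s<..t} \<Longrightarrow> e (i - 1) \<le> e i"
  shows "(\<Sum>i\<in>{s<..t}. integral {e (i - 1)..e i} (\<lambda>x. (x - c i)\<^sup>2)) =
    (e t - e s) ^ 3 / (12 * real (t - s) ^ 2)"
proof -
  have "(\<Sum>i\<in>{s<..t}. integral {e (i - 1)..e i} (\<lambda>x. (x - c i)\<^sup>2)) =
      (\<Sum>i\<in>{s<..t}. ((e t - e s) / real (t - s)) ^ 3 / 12)"
  proof (intro sum.cong refl)
    fix i assume i: "i \<in> {s<..t}"
    show "integral {e (i - 1)..e i} (\<lambda>x. (x - c i)\<^sup>2) = ((e t - e s) / real (t - s)) ^ 3 / 12"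
      unfolding mid[OF i] integral_square_midpoint[OF mono[OF i]]
      by (subst evenly_spaced_bounds[OF mid bd st i]) auto
  qed
  also have "\<dots> = (e t - e s) ^ 3 / (12 * real (t - s) ^ 2)"
  proof -
    have "N * ((D / N) ^ 3 / 12) = D ^ 3 / (12 * N ^ 2)" if "N > 0" for N D :: real
      using that by (simp add: power3_eq_cube power2_eq_square)
    from this[of "real (t - s)" "e t - e s"] show ?thesis using st by simp
  qed
  finally show ?thesis .
qed

section \<open>The shape of optimal sets\<close>

text \<open>
  The cell of \<open>c q\<close> is \<open>[u, v]\<close> and contains the breakpoint. The cells before it lie in \<open>[0, 1]\<close>
  and those after it in \<open>[1, 2]\<close>, so the density is constant on each of them. The bounds
  \<open>1 < q < n\<close> make sure that there are cells on both sides.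
\<close>

lemma optimal_means_if_breakpoint_in_cell:
  fixes p :: real and n q :: nat and c :: "nat \<Rightarrow> real"
  assumes p: "0 < p" "p < 1" and c: "strict_mono_on {1..n} c" "c ` {1..n} \<subseteq> {0..2}"
    and opt: "optimal_n_means n (mixed_uniform p) (c ` {1..n})"
    and q: "1 < q" "q < n"
    and u: "u = (c (q - 1) + c q) / 2" "u \<le> 1" and v: "v = (c q + c (Suc q)) / 2" "1 \<le> v"
  shows "\<forall>j\<in>{1..q - 1}. c j = (2 * real j - 1) / (2 * real (q - 1)) * u" (is ?left)
    and "c q = cond_mean (mixed_uniform p) u v" (is ?middle)
    and "\<forall>j\<in>{1..n - q}. c (q + j) = v + (2 * real j - 1) / (2 * real (n - q)) * (2 - v)" (is ?right)
    and "quantization_error n (mixed_uniform p) = ennreal (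
       p * (u ^ 3 / (12 * real (q - 1) ^ 2))
       + p * integral {u..1} (\<lambda>x. (x - c q)\<^sup>2)
       + (1 - p) * integral {1..v} (\<lambda>x. (x - c q)\<^sup>2)
       + (1 - p) * ((2 - v) ^ 3 / (12 * real (n - q) ^ 2)))" (is ?error)
proof -
  define e where "e = cell_bound n c"
  let ?J = "\<lambda>i. weighted_integral p (\<lambda>x. (x - c i)\<^sup>2) (e (i - 1)) (e i)"
  have n: "1 \<le> n" and p': "0 \<le> p" "p \<le> 1" using p q by auto
  have e0: "e 0 = 0" and en: "e n = 2" using n by (auto simp: e_def cell_bound_def)
  have eu: "e (q - 1) = u" and ev: "e q = v" using q u v by (auto simp: e_def cell_bound_def)
  have less: "e (i - 1) < e i" if "i \<in> {0<..n}" for i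
    unfolding e_def using cell_bound_less[OF c that] .
  have mono: "e i \<le> e j" if "i \<le> j" "j \<le> n" for i j
    unfolding e_def using cell_bound_mono[OF c that] .
  have bd: "e i = (c i + c (Suc i)) / 2" if "i \<in> {0<..<n}" for i
    using that by (simp add: e_def cell_bound_def)
  have centroid: "c i = weighted_integral p (\<lambda>x. x) (e (i - 1)) (e i) /
      weighted_integral p (\<lambda>x. 1) (e (i - 1)) (e i)" if "i \<in> {0<..n}" for i
    unfolding e_def using optimal_point_is_centroid[OF p c n opt that] .
  have le1: "e i \<le> 1" if "i \<in> {0<..q - 1}" for i
  proof -
    have "e i \<le> e (q - 1)" using that q by (intro mono) auto
    then show ?thesis using u(2) eu by simp
  qed
  have ge1: "1 \<le> e (i - 1)" if "i \<in> {q<..n}" for i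
  proof -
    have "e q \<le> e (i - 1)" using that q by (intro mono) auto
    then show ?thesis using v(2) ev by simp
  qed
  have midL: "c i = (e (i - 1) + e i) / 2" if "i \<in> {0<..q - 1}" for i
  proof -
    have i: "i \<in> {0<..n}" using that q by auto
    show ?thesis
      using centroid[OF i] centroid_left[OF p(1) less[OF i] le1[OF that]] by simp
  qed
  have midR: "c i = (e (i - 1) + e i) / 2" if "i \<in> {q<..n}" for i
  proof -
    have i: "i \<in> {0<..n}" using that q by auto
    show ?thesis
      using centroid[OF i] centroid_right[OF p(2) less[OF i] ge1[OF that]] by simp
  qed
  have bdL: "e i = (c i + c (Suc i)) / 2" if "i \<in> {0<..<q - 1}" for i
    by (rule bd) (use that q in auto)
  have bdR: "e i = (c i + c (Suc i)) / 2" if "i \<in> {q<..<n}" for i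
    by (rule bd) (use that q in auto)
  have "0 < q - 1" using q by simp
  note L = evenly_spaced_points[OF midL bdL this] evenly_spaced_error[OF midL bdL this]
  note R = evenly_spaced_points[OF midR bdR q(2)] evenly_spaced_error[OF midR bdR q(2)]
  show ?left using L(1)[unfolded e0 eu] by simp
  show ?right using R(1)[unfolded en ev] by blast
  have "e 0 \<le> e (q - 1)" "e q \<le> e n"
    using q by (intro mono; simp)+
  then have "0 \<le> u" "v \<le> 2"
    unfolding e0 en eu ev by simp_all
  then show ?middle
    using centroid[of q, unfolded eu ev] q p' by (simp add: cond_mean_mixed_uniform)
  have cont: "continuous_on UNIV (\<lambda>x. (x - c i)\<^sup>2)" for i by (intro continuous_intros)
  have "(\<Sum>i\<in>{0<..q - 1}. ?J i) = p * (u ^ 3 / (12 * real (q - 1) ^ 2))"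
  proof -
    have "(\<Sum>i\<in>{0<..q - 1}. ?J i) = p * (\<Sum>i\<in>{0<..q - 1}. integral {e (i - 1)..e i} (\<lambda>x. (x - c i)\<^sup>2))"
      unfolding sum_distrib_left by (intro sum.cong refl weighted_integral_left cont le1)
    also have "(\<Sum>i\<in>{0<..q - 1}. integral {e (i - 1)..e i} (\<lambda>x. (x - c i)\<^sup>2)) =
        (u - 0) ^ 3 / (12 * real (q - 1 - 0) ^ 2)"
      by (rule L(2)[unfolded e0 eu]) (use q in \<open>auto intro!: mono\<close>)
    finally show ?thesis by simp
  qed
  moreover have "(\<Sum>i\<in>{q<..n}. ?J i) = (1 - p) * ((2 - v) ^ 3 / (12 * real (n - q) ^ 2))"
  proof -
    have "(\<Sum>i\<in>{q<..n}. ?J i) = (1 - p) * (\<Sum>i\<in>{q<..n}. integral {e (i - 1)..e i} (\<lambda>x. (x - c i)\<^sup>2))"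
      unfolding sum_distrib_left by (intro sum.cong refl weighted_integral_right cont ge1)
    also have "(\<Sum>i\<in>{q<..n}. integral {e (i - 1)..e i} (\<lambda>x. (x - c i)\<^sup>2)) =
        (2 - v) ^ 3 / (12 * real (n - q) ^ 2)"
      by (rule R(2)[unfolded en ev]) (auto intro!: mono)
    finally show ?thesis .
  qed
  moreover have "?J q = p * integral {u..1} (\<lambda>x. (x - c q)\<^sup>2) + (1 - p) * integral {1..v} (\<lambda>x. (x - c q)\<^sup>2)"
    unfolding eu ev
    using weighted_integral_combine[OF cont u(2) v(2), of p q] weighted_integral_left[OF cont, of 1 p q u]
      weighted_integral_right[OF cont, of 1 p q v] by simp
  moreover have "(\<Sum>i\<in>{0<..n}. ?J i) = (\<Sum>i\<in>{0<..q - 1}. ?J i) + ?J q + (\<Sum>i\<in>{q<..n}. ?J i)"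
  proof -
    have "{0<..n} = insert q ({0<..q - 1} \<union> {q<..n})" using q by auto
    moreover have "(\<Sum>i\<in>{0<..q - 1} \<union> {q<..n}. ?J i) = (\<Sum>i\<in>{0<..q - 1}. ?J i) + (\<Sum>i\<in>{q<..n}. ?J i)"
      by (intro sum.union_disjoint) auto
    ultimately show ?thesis using q by simp
  qed
  ultimately show ?error
    unfolding optimal_error[OF p' c n opt] e_def[symmetric] by (simp add: add.assoc)
qed

text \<open>
  The points of \<open>\<alpha>\<close> in \<open>[0, 1]\<close> and in \<open>(1, 2]\<close> already number \<open>n\<close>, so there are no others, and
  listing first the \<open>a i\<close> and then the \<open>b i\<close> enumerates \<open>\<alpha>\<close> increasingly. In either case the
  exceptional cell contains \<open>1\<close>: the case assumption places one of its ends, and the other is the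
  midpoint of two points on the same side of \<open>1\<close>.
\<close>

theorem proposition2p7:
  fixes p :: real and n k m :: nat and \<alpha> :: "real set" and a b :: "nat \<Rightarrow> real"
  assumes "0 < p" and "p < 1"
    and "n \<ge> 3"
    and "optimal_n_means n (mixed_uniform p) \<alpha>"
    and "\<alpha> \<inter> {0..1} \<noteq> {}" and "\<alpha> \<inter> {1<..2} \<noteq> {}"
    and "\<alpha> \<inter> {0..1} = a ` {1..k}" and "strict_mono_on {1..k} a"
    and "\<alpha> \<inter> {1<..2} = b ` {1..m}" and "strict_mono_on {1..m} b"
    and "k + m = n"
    and "k \<ge> 2" and "m \<ge> 2"
  shows
    "((a k + b 1) / 2 \<le> 1 \<longrightarrow>
        (\<forall>j\<in>{1..k}. a j = (2 * real j - 1) * (a k + b 1) / (4 * real k)) \<and>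
        b 1 = cond_mean (mixed_uniform p) ((a k + b 1) / 2) ((b 1 + b 2) / 2) \<and>
        (\<forall>j\<in>{1..m - 1}. b (1 + j) =
           (b 1 + b 2) / 2 + (2 * real j - 1) / (2 * real (m - 1)) * (2 - (b 1 + b 2) / 2)) \<and>
        quantization_error n (mixed_uniform p) = ennreal (
           p * ((a k + b 1) ^ 3 / (96 * real k ^ 2))
           + p * integral {(a k + b 1) / 2..1} (\<lambda>x. (x - b 1)\<^sup>2)
           + (1 - p) * integral {1..(b 1 + b 2) / 2} (\<lambda>x. (x - b 1)\<^sup>2)
           + (1 - p) * ((4 - (b 1 + b 2)) ^ 3 / (96 * real (m - 1) ^ 2))))
     \<and>
     (1 \<le> (a k + b 1) / 2 \<longrightarrow>
        (\<forall>j\<in>{1..k - 1}. a j = (2 * real j - 1) * (a (k - 1) + a k) / (4 * real (k - 1))) \<and>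
        a k = cond_mean (mixed_uniform p) ((a (k - 1) + a k) / 2) ((a k + b 1) / 2) \<and>
        (\<forall>j\<in>{1..m}. b j =
           (a k + b 1) / 2 + (2 * real j - 1) / (2 * real m) * (2 - (a k + b 1) / 2)) \<and>
        quantization_error n (mixed_uniform p) = ennreal (
           p * ((a (k - 1) + a k) ^ 3 / (96 * real (k - 1) ^ 2))
           + p * integral {(a (k - 1) + a k) / 2..1} (\<lambda>x. (x - a k)\<^sup>2)
           + (1 - p) * integral {1..(a k + b 1) / 2} (\<lambda>x. (x - a k)\<^sup>2)
           + (1 - p) * ((4 - (a k + b 1)) ^ 3 / (96 * real m ^ 2))))"
proof -
  define c where "c i = (if i \<le> k then a i else b (i - k))" for i
  note mono_a = \<open>strict_mono_on {1..k} a\<close> and mono_b = \<open>strict_mono_on {1..m} b\<close>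
  note km = \<open>k + m = n\<close> \<open>k \<ge> 2\<close> \<open>m \<ge> 2\<close>
  note A = \<open>\<alpha> \<inter> {0..1} = a ` {1..k}\<close> and B = \<open>\<alpha> \<inter> {1<..2} = b ` {1..m}\<close>
  have a_range: "0 \<le> a i \<and> a i \<le> 1" if "i \<in> {1..k}" for i
    using A that by (metis Int_iff atLeastAtMost_iff imageI)
  have b_range: "1 < b i \<and> b i \<le> 2" if "i \<in> {1..m}" for i
    using B that by (metis Int_iff greaterThanAtMost_iff imageI)
  have c_image: "c ` {1..n} = a ` {1..k} \<union> b ` {1..m}"
  proof -
    have "{1..n} = {1..k} \<union> (\<lambda>i. i + k) ` {1..m}"
      using km by (simp add: image_add_atLeastAtMost' del: image_add_atLeastAtMost) auto
    moreover have "c ` {1..k} = a ` {1..k}" by (intro image_cong) (auto simp: c_def)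
    moreover have "c ` (\<lambda>i. i + k) ` {1..m} = b ` {1..m}"
      unfolding image_image by (intro image_cong) (auto simp: c_def)
    ultimately show ?thesis by (simp add: image_Un)
  qed
  have c_mono: "strict_mono_on {1..n} c"
  proof (rule strict_mono_onI)
    fix i j assume ij: "i \<in> {1..n}" "j \<in> {1..n}" "i < j"
    consider "j \<le> k" | "i \<le> k" "k < j" | "k < i" by linarith
    then show "c i < c j"
    proof cases
      case 1
      then show ?thesis using ij strict_mono_onD[OF mono_a, of i j] by (simp add: c_def)
    next
      case 2
      then show ?thesis using ij km a_range[of i] b_range[of "j - k"] by (force simp: c_def)
    next
      case 3
      then show ?thesis
        using ij km strict_mono_onD[OF mono_b, of "i - k" "j - k"] by (simp add: c_def)
    qed
  qed
  have c_range: "c ` {1..n} \<subseteq> {0..2}"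
    unfolding c_image A[symmetric] B[symmetric] by auto
  have "c ` {1..n} = \<alpha>"
  proof -
    have le: "1 \<le> card \<alpha>" "card \<alpha> \<le> n"
      using \<open>optimal_n_means n (mixed_uniform p) \<alpha>\<close> by (auto simp: optimal_n_means_def)
    have "card (c ` {1..n}) = n"
      using strict_mono_on_imp_inj_on[OF c_mono] by (simp add: card_image)
    moreover have "finite \<alpha>" using le(1) by (simp add: card_ge_0_finite)
    moreover have "c ` {1..n} \<subseteq> \<alpha>" unfolding c_image using A B by blast
    ultimately show ?thesis using le(2) by (intro card_seteq) auto
  qed
  then have opt: "optimal_n_means n (mixed_uniform p) (c ` {1..n})"
    using \<open>optimal_n_means n (mixed_uniform p) \<alpha>\<close> by simp
  note breaking_cell = optimal_means_if_breakpoint_in_cell[OF \<open>0 < p\<close> \<open>p < 1\<close> c_mono c_range opt _ _ refl _ refl]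
  have tail: "(2 - x / 2) ^ 3 / (12 * y) = (4 - x) ^ 3 / (96 * y)" for x y :: real
  proof -
    have "2 - x / 2 = (4 - x) / 2" by (simp add: diff_divide_distrib)
    then show ?thesis by (simp only: power_divide) simp
  qed
  show ?thesis
  proof (intro conjI[of "_ \<longrightarrow> _"] impI)
    \<comment> \<open>The cell of \<open>b 1 = c (k + 1)\<close> contains \<open>1\<close>.\<close>
    assume le: "(a k + b 1) / 2 \<le> 1"
    have cs: "c (Suc k - 1) = a k" "c (Suc k) = b 1" "c (Suc (Suc k)) = b 2"
      using km by (auto simp: c_def numeral_2_eq_2)
    have ge: "1 \<le> (b 1 + b 2) / 2"
      using b_range[of 1] b_range[of 2] km by simp
    note S = breaking_cell[of "Suc k", unfolded cs, OF _ _ le ge]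
    have N: "n - Suc k = m - 1" "1 < Suc k" "Suc k < n" "Suc k - 1 = k" using km by auto
    show "(\<forall>j\<in>{1..k}. a j = (2 * real j - 1) * (a k + b 1) / (4 * real k)) \<and>
        b 1 = cond_mean (mixed_uniform p) ((a k + b 1) / 2) ((b 1 + b 2) / 2) \<and>
        (\<forall>j\<in>{1..m - 1}. b (1 + j) =
           (b 1 + b 2) / 2 + (2 * real j - 1) / (2 * real (m - 1)) * (2 - (b 1 + b 2) / 2)) \<and>
        quantization_error n (mixed_uniform p) = ennreal (
           p * ((a k + b 1) ^ 3 / (96 * real k ^ 2))
           + p * integral {(a k + b 1) / 2..1} (\<lambda>x. (x - b 1)\<^sup>2)
           + (1 - p) * integral {1..(b 1 + b 2) / 2} (\<lambda>x. (x - b 1)\<^sup>2)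
           + (1 - p) * ((4 - (b 1 + b 2)) ^ 3 / (96 * real (m - 1) ^ 2)))"
    proof (intro conjI ballI)
      fix j assume j: "j \<in> {1..k}"
      have "a j = c j" using j by (simp add: c_def)
      also have "c j = (2 * real j - 1) / (2 * real k) * ((a k + b 1) / 2)"
        using S(1)[OF N(2,3)] j unfolding N(4) by blast
      finally show "a j = (2 * real j - 1) * (a k + b 1) / (4 * real k)"
        by simp
    next
      show "b 1 = cond_mean (mixed_uniform p) ((a k + b 1) / 2) ((b 1 + b 2) / 2)"
        using S(2)[OF N(2,3)] .
    next
      fix j assume "j \<in> {1..m - 1}"
      moreover have "c (Suc k + j) = b (1 + j)" by (simp add: c_def)
      ultimately show "b (1 + j) = (b 1 + b 2) / 2
          + (2 * real j - 1) / (2 * real (m - 1)) * (2 - (b 1 + b 2) / 2)"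
        using S(3)[OF N(2,3)] unfolding N(1) by metis
    next
      have "((a k + b 1) / 2) ^ 3 / (12 * real k ^ 2) = (a k + b 1) ^ 3 / (96 * real k ^ 2)"
        by (simp add: power_divide)
      moreover have "(2 - (b 1 + b 2) / 2) ^ 3 / (12 * real (m - 1) ^ 2) =
          (4 - (b 1 + b 2)) ^ 3 / (96 * real (m - 1) ^ 2)"
        by (rule tail)
      ultimately show "quantization_error n (mixed_uniform p) = ennreal (
           p * ((a k + b 1) ^ 3 / (96 * real k ^ 2))
           + p * integral {(a k + b 1) / 2..1} (\<lambda>x. (x - b 1)\<^sup>2)
           + (1 - p) * integral {1..(b 1 + b 2) / 2} (\<lambda>x. (x - b 1)\<^sup>2)
           + (1 - p) * ((4 - (b 1 + b 2)) ^ 3 / (96 * real (m - 1) ^ 2)))"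
        using S(4)[OF N(2,3)] unfolding N(1,4) by metis
    qed
  next
    \<comment> \<open>The cell of \<open>a k = c k\<close> contains \<open>1\<close>.\<close>
    assume ge: "1 \<le> (a k + b 1) / 2"
    have cs: "c (k - 1) = a (k - 1)" "c k = a k" "c (Suc k) = b 1"
      using km by (auto simp: c_def)
    have le: "(a (k - 1) + a k) / 2 \<le> 1"
      using a_range[of "k - 1"] a_range[of k] km by force
    note S = breaking_cell[of k, unfolded cs, OF _ _ le ge]
    have N: "n - k = m" "1 < k" "k < n" using km by auto
    show "(\<forall>j\<in>{1..k - 1}. a j = (2 * real j - 1) * (a (k - 1) + a k) / (4 * real (k - 1))) \<and>
        a k = cond_mean (mixed_uniform p) ((a (k - 1) + a k) / 2) ((a k + b 1) / 2) \<and>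
        (\<forall>j\<in>{1..m}. b j =
           (a k + b 1) / 2 + (2 * real j - 1) / (2 * real m) * (2 - (a k + b 1) / 2)) \<and>
        quantization_error n (mixed_uniform p) = ennreal (
           p * ((a (k - 1) + a k) ^ 3 / (96 * real (k - 1) ^ 2))
           + p * integral {(a (k - 1) + a k) / 2..1} (\<lambda>x. (x - a k)\<^sup>2)
           + (1 - p) * integral {1..(a k + b 1) / 2} (\<lambda>x. (x - a k)\<^sup>2)
           + (1 - p) * ((4 - (a k + b 1)) ^ 3 / (96 * real m ^ 2)))"
    proof (intro conjI ballI)
      fix j assume j: "j \<in> {1..k - 1}"
      then have "a j = c j" by (auto simp: c_def)
      also have "c j = (2 * real j - 1) / (2 * real (k - 1)) * ((a (k - 1) + a k) / 2)"
        using S(1)[OF N(2,3)] j by blast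
      finally show "a j = (2 * real j - 1) * (a (k - 1) + a k) / (4 * real (k - 1))"
        by simp
    next
      show "a k = cond_mean (mixed_uniform p) ((a (k - 1) + a k) / 2) ((a k + b 1) / 2)"
        using S(2)[OF N(2,3)] .
    next
      fix j assume "j \<in> {1..m}"
      moreover from this have "c (k + j) = b j" by (simp add: c_def)
      ultimately show "b j = (a k + b 1) / 2
          + (2 * real j - 1) / (2 * real m) * (2 - (a k + b 1) / 2)"
        using S(3)[OF N(2,3)] unfolding N(1) by metis
    next
      have "((a (k - 1) + a k) / 2) ^ 3 / (12 * real (k - 1) ^ 2) =
          (a (k - 1) + a k) ^ 3 / (96 * real (k - 1) ^ 2)"
        by (simp add: power_divide)
      moreover have "(2 - (a k + b 1) / 2) ^ 3 / (12 * real m ^ 2) =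
          (4 - (a k + b 1)) ^ 3 / (96 * real m ^ 2)"
        by (rule tail)
      ultimately show "quantization_error n (mixed_uniform p) = ennreal (
           p * ((a (k - 1) + a k) ^ 3 / (96 * real (k - 1) ^ 2))
           + p * integral {(a (k - 1) + a k) / 2..1} (\<lambda>x. (x - a k)\<^sup>2)
           + (1 - p) * integral {1..(a k + b 1) / 2} (\<lambda>x. (x - a k)\<^sup>2)
           + (1 - p) * ((4 - (a k + b 1)) ^ 3 / (96 * real m ^ 2)))"
        using S(4)[OF N(2,3)] unfolding N(1) by metis
    qed
  qed
qed

end
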